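(* Let $U,V\subseteq\mathbb{R}^n$ be linear subspaces with $V\not\subset U$. If $V\subset U^\perp$ (so in particular $U\cap V=\{0\}$), then $\rho_V=0$ and the circumcentered--reflection method started from $V$ converges in one step: $C_T(P_Vx_0)=P_{U\cap V}(x_0)$ for every $x_0\in\mathbb{R}^n$. This holds regardless of $\dim V$.
   Context: For a linear subspace $W\subseteq\mathbb{R}^n$, $P_W$ is the orthogonal projection onto $W$ and $R_W=2P_W-\mathrm{Id}$. With $p=\dim V$, $s=\dim(U\cap V)<p$, let $\sigma_1\ge\dots\ge\sigma_p\ge0$ be the singular values of $P_U|_V:V\to\mathbb{R}^n$ and $\theta_k=\arccos\sigma_k$ the principal angles ($0\le\theta_1\le\dots\le\theta_p\le\pi/2$, the first $s$ equal to $0$). The Friedrichs angle is $\theta_F:=\theta_{s+1}\in(0,\pi/2]$, and $$\rho_V:=\frac{\sin^2\theta_p-\sin^2\theta_F}{\sin^2\theta_p+\sin^2\theta_F}.$$ Circumcenter: for a finite set $S\subset\mathbb{R}^n$ for which some point $q\in\mathbb{R}^n$ is equidistant from all elements of $S$, $\mathrm{circumcenter}(S):=P_{\mathrm{aff}(S)}(q)$, the orthogonal projection of $q$ onto the affine hull of $S$ (independent of the choice of $q$). $C_T(x):=\mathrm{circumcenter}\{x,R_Ux,R_VR_Ux\}$ (any point of $U\cap V$ is equidistant from the three vertices). *)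

theory Defs
  imports "HOL-Analysis.Analysis" "HOL-Library.Multiset"
begin

text \<open>
  The orthogonal projection onto a linear or affine subspace is the nearest-point map
  \<^const>\<open>closest_point\<close>.
\<close>

lemma closest_point_affine_iff:
  fixes A :: "'a::euclidean_space set"
  assumes "affine A" "A \<noteq> {}"
  shows "closest_point A x = p \<longleftrightarrow> p \<in> A \<and> (\<forall>a\<in>A. orthogonal (x - p) (a - p))"
proof -
  have cl: "closed A" using assms(1) by (rule affine_closed)
  have co: "convex A" using assms(1) by (rule affine_imp_convex)
  have 1: "closest_point A x \<in> A" using cl assms(2) by (rule closest_point_in_set)
  have 2: "orthogonal (x - p) (a - p)" if p: "p = closest_point A x" and a: "a \<in> A" for a p
  proof -
    have "(1 - 2) *\<^sub>R a + 2 *\<^sub>R p \<in> A"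
      using assms(1) a 1 unfolding affine_alt p by blast
    then have "(x - p) \<bullet> (((1 - 2) *\<^sub>R a + 2 *\<^sub>R p) - p) \<le> 0"
      using closest_point_dot[OF co cl] p by blast
    moreover have "((1 - 2) *\<^sub>R a + 2 *\<^sub>R p) - p = - (a - p)"
      by (simp add: scaleR_2)
    ultimately have "(x - p) \<bullet> (a - p) \<ge> 0" by (metis inner_minus_right neg_le_0_iff_le)
    moreover have "(x - p) \<bullet> (a - p) \<le> 0"
      using closest_point_dot[OF co cl a] p by blast
    ultimately show ?thesis by (simp add: orthogonal_def)
  qed
  have 3: "p = closest_point A x" if p: "p \<in> A" and o: "\<forall>a\<in>A. orthogonal (x - p) (a - p)"
  proof (rule closest_point_unique[OF co cl p])
    show "\<forall>z\<in>A. dist x p \<le> dist x z"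
    proof
      fix z assume "z \<in> A"
      then have "(x - p) \<bullet> (z - p) = 0" using o by (simp add: orthogonal_def)
      then have "(norm ((x - p) - (z - p)))\<^sup>2 = (norm (x - p))\<^sup>2 + (norm (z - p))\<^sup>2"
        by (simp only: power2_norm_eq_inner inner_diff_left[of "x - p" "z - p"]
          inner_diff_right[of _ "x - p" "z - p"] inner_commute[of "z - p" "x - p"])
      then have "(norm (x - p))\<^sup>2 \<le> (norm (x - z))\<^sup>2" by simp
      then show "dist x p \<le> dist x z"
        unfolding dist_norm by (rule power2_le_imp_le) (rule norm_ge_zero)
    qed
  qed
  show ?thesis
  proof
    assume p: "closest_point A x = p"
    show "p \<in> A \<and> (\<forall>a\<in>A. orthogonal (x - p) (a - p))" using 1 2[OF p[symmetric]] p by simp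
  next
    assume "p \<in> A \<and> (\<forall>a\<in>A. orthogonal (x - p) (a - p))"
    then show "closest_point A x = p" using 3 by simp
  qed
qed

definition reflection :: "'a::euclidean_space set \<Rightarrow> 'a \<Rightarrow> 'a" where
  "reflection W x = 2 *\<^sub>R closest_point W x - x"

text \<open>
  For a linear map \<open>A\<close> on the whole space, the adjoint of its restriction to the subspace
  \<open>V\<close> is \<open>y \<mapsto> closest_point V (adjoint A y)\<close>, so the following set is the eigenspace
  of (A restricted to V)* (A restricted to V), an operator on \<open>V\<close>, for the eigenvalue \<open>\<mu>\<close>.
\<close>

definition gram_eigenspace :: "'a::euclidean_space set \<Rightarrow> ('a \<Rightarrow> 'a) \<Rightarrow> real \<Rightarrow> 'a set" where
  "gram_eigenspace V A \<mu> = {v\<in>V. closest_point V (adjoint A (A v)) = \<mu> *\<^sub>R v}"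

text \<open>
  The singular values of the restriction of \<open>A\<close> to \<open>V\<close>: square roots of the eigenvalues above,
  with multiplicity, in non-increasing order. Indices start at 0.
\<close>

definition singular_values :: "'a::euclidean_space set \<Rightarrow> ('a \<Rightarrow> 'a) \<Rightarrow> real list" where
  "singular_values V A = rev (sorted_list_of_multiset
     (Abs_multiset (\<lambda>\<sigma>. if 0 \<le> \<sigma> then dim (gram_eigenspace V A (\<sigma>\<^sup>2)) else 0)))"

text \<open>
  The multiplicity function has finite support, as \<^const>\<open>Abs_multiset\<close> requires.
\<close>

lemma gram_eigenspace_inner:
  fixes A :: "'a::euclidean_space \<Rightarrow> 'a"
  assumes "subspace V" "linear A" "v \<in> gram_eigenspace V A \<mu>" "w \<in> V"
  shows "A v \<bullet> A w = \<mu> * (v \<bullet> w)"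
proof -
  let ?x = "adjoint A (A v)"
  have v: "v \<in> V" "closest_point V ?x = \<mu> *\<^sub>R v"
    using assms(3) by (auto simp: gram_eigenspace_def)
  have ne: "V \<noteq> {}" using v by blast
  have o: "\<forall>a\<in>V. orthogonal (?x - \<mu> *\<^sub>R v) (a - \<mu> *\<^sub>R v)"
    using closest_point_affine_iff[OF subspace_imp_affine[OF assms(1)] ne, THEN iffD1, OF v(2)]
    by (rule conjunct2)
  have "w + \<mu> *\<^sub>R v \<in> V" using assms(1,4) v by (simp add: subspace_add subspace_scale)
  then have "orthogonal (?x - \<mu> *\<^sub>R v) ((w + \<mu> *\<^sub>R v) - \<mu> *\<^sub>R v)" using o by (rule bspec[rotated])
  then have "(?x - \<mu> *\<^sub>R v) \<bullet> w = 0" by (simp add: orthogonal_def)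
  moreover have "?x \<bullet> w = A v \<bullet> A w"
    using adjoint_works[OF assms(2), of w "A v"] by (simp add: inner_commute)
  ultimately show ?thesis by (simp add: inner_diff_left)
qed

lemma finite_singular_support:
  fixes A :: "'a::euclidean_space \<Rightarrow> 'a"
  assumes V: "subspace V" and A: "linear A"
  shows "finite {\<sigma>. 0 < (if 0 \<le> \<sigma> then dim (gram_eigenspace V A (\<sigma>\<^sup>2)) else 0)}"
    (is "finite ?S")
proof -
  have "\<exists>v. v \<in> gram_eigenspace V A (\<sigma>\<^sup>2) \<and> v \<noteq> 0" if "\<sigma> \<in> ?S" for \<sigma>
  proof (rule ccontr)
    assume "\<not> ?thesis"
    then have "gram_eigenspace V A (\<sigma>\<^sup>2) \<subseteq> {0}" by blast
    then have "dim (gram_eigenspace V A (\<sigma>\<^sup>2)) = 0" by (simp only: dim_eq_0)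
    moreover have "0 < dim (gram_eigenspace V A (\<sigma>\<^sup>2))" using that by (simp split: if_splits)
    ultimately show False by linarith
  qed
  then obtain f where f: "\<And>\<sigma>. \<sigma> \<in> ?S \<Longrightarrow> f \<sigma> \<in> gram_eigenspace V A (\<sigma>\<^sup>2) \<and> f \<sigma> \<noteq> 0"
    using bchoice[of ?S "\<lambda>\<sigma> v. v \<in> gram_eigenspace V A (\<sigma>\<^sup>2) \<and> v \<noteq> 0"] by blast
  have orth: "f \<sigma> \<bullet> f \<tau> = 0" if "\<sigma> \<in> ?S" "\<tau> \<in> ?S" "\<sigma> \<noteq> \<tau>" for \<sigma> \<tau>
  proof -
    have "f \<sigma> \<in> V" "f \<tau> \<in> V" using f[OF that(1)] f[OF that(2)] by (simp_all add: gram_eigenspace_def)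
    then have "\<sigma>\<^sup>2 * (f \<sigma> \<bullet> f \<tau>) = \<tau>\<^sup>2 * (f \<sigma> \<bullet> f \<tau>)"
      using gram_eigenspace_inner[OF V A, of "f \<sigma>" "\<sigma>\<^sup>2" "f \<tau>"]
        gram_eigenspace_inner[OF V A, of "f \<tau>" "\<tau>\<^sup>2" "f \<sigma>"] f[OF that(1)] f[OF that(2)]
      by (simp add: inner_commute)
    moreover have "\<sigma>\<^sup>2 \<noteq> \<tau>\<^sup>2"
    proof -
      have "0 \<le> \<sigma>" "0 \<le> \<tau>" using that(1,2) by (simp_all split: if_splits)
      then show ?thesis using that(3) by (simp add: power2_eq_iff_nonneg)
    qed
    ultimately show ?thesis by simp
  qed
  have inj: "inj_on f ?S"
  proof (rule inj_onI, rule ccontr)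
    fix \<sigma> \<tau> assume st: "\<sigma> \<in> ?S" "\<tau> \<in> ?S" "f \<sigma> = f \<tau>" "\<sigma> \<noteq> \<tau>"
    then have "f \<sigma> \<bullet> f \<sigma> = 0" using orth[OF st(1,2,4)] by simp
    then show False using f[OF st(1)] by simp
  qed
  have "pairwise orthogonal (f ` ?S)"
    unfolding pairwise_image using orth by (simp only: pairwise_def orthogonal_def) blast
  moreover have "0 \<notin> f ` ?S"
  proof
    assume "0 \<in> f ` ?S"
    then obtain \<sigma> where "\<sigma> \<in> ?S" "f \<sigma> = 0" by (elim imageE) simp
    then show False using f by blast
  qed
  ultimately have "independent (f ` ?S)" by (rule pairwise_orthogonal_independent)
  then have "finite (f ` ?S)" by (rule independent_imp_finite)
  then show ?thesis using inj by (rule finite_imageD)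
qed

text \<open>
  The angle \<open>principal_angle U V k\<close> is \<open>\<theta>\<^sub>k\<close>, for \<open>1 \<le> k \<le> dim V\<close>.
\<close>

definition principal_angle :: "'a::euclidean_space set \<Rightarrow> 'a set \<Rightarrow> nat \<Rightarrow> real" where
  "principal_angle U V k = arccos (singular_values V (closest_point U) ! (k - 1))"

definition friedrichs_angle :: "'a::euclidean_space set \<Rightarrow> 'a set \<Rightarrow> real" where
  "friedrichs_angle U V = principal_angle U V (dim (U \<inter> V) + 1)"

definition rho :: "'a::euclidean_space set \<Rightarrow> 'a set \<Rightarrow> real" where
  "rho U V =
    ((sin (principal_angle U V (dim V)))\<^sup>2 - (sin (friedrichs_angle U V))\<^sup>2) /
    ((sin (principal_angle U V (dim V)))\<^sup>2 + (sin (friedrichs_angle U V))\<^sup>2)"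

definition equidistant :: "'a::euclidean_space set \<Rightarrow> 'a \<Rightarrow> bool" where
  "equidistant S q \<longleftrightarrow> (\<exists>r. \<forall>s\<in>S. dist q s = r)"

definition circumcenter :: "'a::euclidean_space set \<Rightarrow> 'a" where
  "circumcenter S = closest_point (affine hull S) (SOME q. equidistant S q)"

lemma circumcenter_eq:
  fixes S :: "'a::euclidean_space set"
  assumes q: "equidistant S q"
  shows "circumcenter S = closest_point (affine hull S) q"
proof (cases "S = {}")
  case True
  then show ?thesis by (simp add: circumcenter_def closest_point_def)
next
  case False
  define q' where "q' = (SOME q. equidistant S q)"
  have q': "equidistant S q'" unfolding q'_def using q by (rule someI)
  let ?H = "affine hull S"
  have ne: "?H \<noteq> {}" using False by simp
  let ?p = "closest_point ?H q"
  note iff = closest_point_affine_iff[OF affine_affine_hull ne]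
  have "?p \<in> ?H \<and> (\<forall>a\<in>?H. orthogonal (q - ?p) (a - ?p))" by (rule iff[THEN iffD1]) (rule refl)
  then have p: "?p \<in> ?H" "\<forall>a\<in>?H. orthogonal (q - ?p) (a - ?p)" by simp_all
  obtain s0 where s0: "s0 \<in> S" using False by blast
  let ?T = "{a. (q - q') \<bullet> a = (q - q') \<bullet> s0}"
  have "S \<subseteq> ?T"
  proof
    fix s assume "s \<in> S"
    then have "dist q s = dist q s0" "dist q' s = dist q' s0"
      using q q' s0 unfolding equidistant_def by metis+
    then have "(norm (q - s))\<^sup>2 = (norm (q - s0))\<^sup>2" "(norm (q' - s))\<^sup>2 = (norm (q' - s0))\<^sup>2"
      by (simp_all add: dist_norm)
    then show "s \<in> ?T"
      by (simp add: power2_norm_eq_inner algebra_simps inner_commute)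
  qed
  then have HT: "?H \<subseteq> ?T" by (rule hull_minimal) (rule affine_hyperplane)
  have eq: "(q - q') \<bullet> a = (q - q') \<bullet> ?p" if "a \<in> ?H" for a
    using subsetD[OF HT that] subsetD[OF HT p(1)] by simp
  have "\<forall>a\<in>?H. orthogonal (q' - ?p) (a - ?p)"
  proof
    fix a assume a: "a \<in> ?H"
    have "(q - ?p) \<bullet> (a - ?p) = 0" using p(2) a by (simp add: orthogonal_def)
    moreover have "(q - q') \<bullet> (a - ?p) = 0" using eq[OF a] by (simp add: inner_diff_right)
    ultimately show "orthogonal (q' - ?p) (a - ?p)"
      by (simp add: orthogonal_def inner_diff_left)
  qed
  then have "closest_point ?H q' = ?p" by (intro iff[THEN iffD2] conjI p(1))
  then show ?thesis by (simp add: circumcenter_def q'_def)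
qed

definition crm :: "'a::euclidean_space set \<Rightarrow> 'a set \<Rightarrow> 'a \<Rightarrow> 'a" where
  "crm U V x = circumcenter {x, reflection U x, reflection V (reflection U x)}"

end

theory Submission
  imports Defs
begin

text \<open>
  If \<open>V\<close> is orthogonal to \<open>U\<close>, the projection onto \<open>U\<close> vanishes on \<open>V\<close>. Hence its restriction to
  \<open>V\<close> is the zero map, all \<open>dim V\<close> singular values are \<open>0\<close> (\<open>singular_values_zero_map\<close>), and
  every principal angle is \<open>\<pi>/2\<close>. Since \<open>V \<noteq> {0}\<close>, there is at least one such angle; so the largest
  angle and the Friedrichs angle exist and coincide, and the numerator of the rate is \<open>0\<close>.

  For the method, let \<open>x\<close> be a point of \<open>V\<close>. Reflecting in \<open>U\<close> sends \<open>x\<close> to \<open>-x\<close>, which lies in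
  \<open>V\<close> again and is fixed by the second reflection. The triangle therefore degenerates to the
  segment from \<open>x\<close> to \<open>-x\<close>, whose circumcenter is its midpoint \<open>0\<close>
  (\<open>circumcenter_antipodal\<close>), the only point of \<open>U \<inter> V\<close>.
\<close>

lemma closest_point_subspace_iff:
  fixes W :: "'a::euclidean_space set"
  assumes W: "subspace W"
  shows "closest_point W x = p \<longleftrightarrow> p \<in> W \<and> x - p \<in> W\<^sup>\<bottom>"
proof -
  have "W \<noteq> {}" using subspace_0[OF W] by blast
  then have iff: "closest_point W x = p \<longleftrightarrow> p \<in> W \<and> (\<forall>a\<in>W. orthogonal (x - p) (a - p))"
    using closest_point_affine_iff subspace_imp_affine[OF W] by blast
  have "(\<forall>a\<in>W. orthogonal (x - p) (a - p)) \<longleftrightarrow> (\<forall>a\<in>W. orthogonal (x - p) a)" if "p \<in> W"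
  proof (intro iffI ballI)
    fix a assume h: "\<forall>a\<in>W. orthogonal (x - p) (a - p)" and "a \<in> W"
    then have "a + p \<in> W" using W that by (simp add: subspace_add)
    with h have "orthogonal (x - p) ((a + p) - p)" by (rule bspec)
    then show "orthogonal (x - p) a" by simp
  next
    fix a assume "\<forall>a\<in>W. orthogonal (x - p) a" "a \<in> W"
    then show "orthogonal (x - p) (a - p)" using W that by (simp add: subspace_diff)
  qed
  then show ?thesis using iff by (auto simp: orthogonal_comp_def orthogonal_commute)
qed

lemma linear_closest_point_subspace:
  fixes W :: "'a::euclidean_space set"
  assumes W: "subspace W"
  shows "linear (closest_point W)"
proof -
  note iff = closest_point_subspace_iff[OF W]
  note C = subspace_orthogonal_comp[of W]
  have cp: "closest_point W x \<in> W" "x - closest_point W x \<in> W\<^sup>\<bottom>" for x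
    using iff[of x "closest_point W x"] by simp_all
  show ?thesis
  proof (rule linearI)
    fix x y
    have "(x - closest_point W x) + (y - closest_point W y) \<in> W\<^sup>\<bottom>"
      using C cp(2) cp(2) by (rule subspace_add)
    then show "closest_point W (x + y) = closest_point W x + closest_point W y"
      using W cp(1) by (simp add: iff subspace_add algebra_simps)
  next
    fix r x
    have "r *\<^sub>R (x - closest_point W x) \<in> W\<^sup>\<bottom>"
      using C cp(2) by (rule subspace_scale)
    then show "closest_point W (r *\<^sub>R x) = r *\<^sub>R closest_point W x"
      using W cp(1) by (simp add: iff subspace_scale algebra_simps)
  qed
qed

lemma closest_point_orthogonal_comp:
  fixes W :: "'a::euclidean_space set"
  assumes "subspace W" "x \<in> W\<^sup>\<bottom>"
  shows "closest_point W x = 0"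
  using assms by (simp add: closest_point_subspace_iff subspace_0)

lemma gram_eigenspace_zero_map:
  fixes A :: "'a::euclidean_space \<Rightarrow> 'a"
  assumes V: "subspace V" and A: "linear A" and zero: "\<And>v. v \<in> V \<Longrightarrow> A v = 0"
  shows "gram_eigenspace V A \<mu> = (if \<mu> = 0 then V else {0})"
proof -
  have "adjoint A 0 = 0"
    using adjoint_linear[OF A] by (rule linear_0)
  moreover have "closest_point V 0 = 0"
    using linear_closest_point_subspace[OF V] by (rule linear_0)
  ultimately show ?thesis
    using zero subspace_0[OF V] by (auto simp: gram_eigenspace_def)
qed

text \<open>
  The Gram operator of a map that vanishes on \<open>V\<close> is the zero operator on \<open>V\<close>: the
  eigenspace for \<open>0\<close> is all of \<open>V\<close>, and every other one is trivial. So \<open>0\<close> alone exhausts the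
  \<open>dim V\<close> singular values.
\<close>

lemma singular_values_zero_map:
  fixes A :: "'a::euclidean_space \<Rightarrow> 'a"
  assumes V: "subspace V" and A: "linear A" and zero: "\<And>v. v \<in> V \<Longrightarrow> A v = 0"
  shows "singular_values V A = replicate (dim V) 0"
proof -
  have "(\<lambda>\<sigma>. if 0 \<le> \<sigma> then dim (gram_eigenspace V A (\<sigma>\<^sup>2)) else 0)
      = count (replicate_mset (dim V) (0::real))"
    by (rule ext) (simp add: gram_eigenspace_zero_map[OF assms])
  then have "singular_values V A
      = rev (sorted_list_of_multiset (mset (replicate (dim V) (0::real))))"
    by (simp add: singular_values_def count_inverse)
  also have "\<dots> = rev (sort (replicate (dim V) 0))"
    by (simp only: sorted_list_of_multiset_mset)
  also have "\<dots> = replicate (dim V) 0"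
    by (simp add: sorted_sort_id)
  finally show ?thesis .
qed

lemma principal_angle_orthogonal:
  fixes U V :: "'a::euclidean_space set"
  assumes "subspace U" "subspace V" "V \<subseteq> U\<^sup>\<bottom>" "1 \<le> k" "k \<le> dim V"
  shows "principal_angle U V k = pi / 2"
proof -
  have "singular_values V (closest_point U) = replicate (dim V) 0"
    using assms by (intro singular_values_zero_map linear_closest_point_subspace)
      (auto intro: closest_point_orthogonal_comp)
  then show ?thesis using assms(4,5) by (simp add: principal_angle_def)
qed

lemma circumcenter_antipodal:
  fixes x :: "'a::euclidean_space"
  shows "circumcenter {x, - x} = 0"
proof -
  have "equidistant {x, - x} 0" by (simp add: equidistant_def)
  then have "circumcenter {x, - x} = closest_point (affine hull {x, - x}) 0"
    by (rule circumcenter_eq)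
  also have "\<dots> = 0"
  proof (rule closest_point_self)
    have "0 = (1/2) *\<^sub>R x + (1/2) *\<^sub>R (- x)" by simp
    then show "0 \<in> affine hull {x, - x}" unfolding affine_hull_2
      by (intro CollectI exI[of _ "1/2"]) simp
  qed
  finally show ?thesis .
qed

lemma crm_orthogonal:
  fixes U V :: "'a::euclidean_space set"
  assumes "subspace U" "subspace V" "V \<subseteq> U\<^sup>\<bottom>" "x \<in> V"
  shows "crm U V x = 0"
proof -
  have U: "reflection U x = - x"
    using assms by (simp add: reflection_def closest_point_orthogonal_comp subsetD)
  have "- x \<in> V" using assms(2,4) by (rule subspace_neg)
  then have "reflection V (- x) = - x"
    by (simp add: reflection_def closest_point_self scaleR_2)
  with U show ?thesis by (simp add: crm_def circumcenter_antipodal)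
qed

theorem corollary4p7:
  fixes U V :: "(real ^ 'n) set"
  assumes "subspace U" and "subspace V"
    and "\<not> V \<subseteq> U"
    and "V \<subseteq> U\<^sup>\<bottom>"
  shows "U \<inter> V = {0} \<and> rho U V = 0 \<and>
    (\<forall>x0. crm U V (closest_point V x0) = closest_point (U \<inter> V) x0)"
proof -
  have "v = 0" if "v \<in> U" "v \<in> V" for v
    using that assms(4) orthogonal_self by (auto simp: orthogonal_comp_def)
  then have UV: "U \<inter> V = {0}"
    using assms(1,2) subspace_0 by blast
  have "\<not> V \<subseteq> {0}" using assms(1,3) subspace_0 by blast
  then have "dim V \<noteq> 0" by (simp only: dim_eq_0) simp
  then have p: "1 \<le> dim V" by linarith
  have "principal_angle U V (dim V) = pi / 2"
    using assms(1,2,4) p by (intro principal_angle_orthogonal) simp_all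
  moreover have "friedrichs_angle U V = pi / 2"
    unfolding friedrichs_angle_def UV
    using assms(1,2,4) p by (intro principal_angle_orthogonal) simp_all
  ultimately have "principal_angle U V (dim V) = friedrichs_angle U V" by simp
  then have "rho U V = 0" by (simp add: rho_def)
  moreover have "crm U V (closest_point V x0) = closest_point (U \<inter> V) x0" for x0
  proof -
    have "closest_point V x0 \<in> V"
      using closest_point_subspace_iff[OF assms(2), of x0 "closest_point V x0"] by simp
    then have "crm U V (closest_point V x0) = 0"
      using assms(1,2,4) by (intro crm_orthogonal)
    moreover have "closest_point {0} x0 = 0"
      using closest_point_in_set[of "{0}" x0] by simp
    ultimately show ?thesis using UV by simp
  qed
  ultimately show ?thesis using UV by blast
qed

end
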